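(* Let $L, R$ be nonempty subsets of a group $G$. Then the two-sided Cayley graph $\mathrm{2SCay}(G;L,R)$ is a simple undirected graph if and only if $(L,R)$ has the $2$S-Cayley property. If this is the case then $\mathrm{2SCay}(G;L,R)$ has valency $|L|\cdot|R|$.
   Context: Let $G$ be a group with identity $e$; for $X\subseteq G$ and $g\in G$ write $X^{-1}=\{x^{-1}: x\in X\}$, $X^g=g^{-1}Xg$, and $XY=\{xy: x\in X, y\in Y\}$. For non-empty subsets $L,R$ of $G$, the two-sided Cayley graph $\mathrm{2SCay}(G;L,R)$ is the directed graph with vertex set $G$ with an arc from $x$ to $y$ if and only if $y=\ell^{-1}xr$ for some $\ell\in L$, $r\in R$. Arcs are counted with multiplicity: each pair $(\ell,r)\in L\times R$ gives an arc from $x$ to $\ell^{-1}xr$, and the graph contains multiple arcs if for some $x,y\in G$ there are at least two arcs from $x$ to $y$, i.e. $y=\ell_1^{-1}xr_1=\ell_2^{-1}xr_2$ for two distinct pairs $(\ell_i,r_i)\in L\times R$. If the adjacency relation is symmetric ($(x,y)$ is an arc iff $(y,x)$ is an arc), the graph is regarded as undirected. It is a simple undirected graph if the adjacency relation is symmetric and there are no loops and no multiple arcs. A pair $(L,R)$ of subsets of $G$ has the $2$S-Cayley property if both $L,R$ are non-empty and: (1) $L^{-1}gR=LgR^{-1}$ for each $g\in G$; (2) $L^g\cap R=\varnothing$ for each $g\in G$; (3) $(LL^{-1})^g\cap (RR^{-1})=\{e\}$ for each $g\in G$. *)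

theory Defs
  imports "HOL-Algebra.Coset" "Graph_Theory.Digraph"
begin

unbundle cardinal_syntax

text \<open>
  The triple \<open>(x, l, r)\<close> is the arc from \<open>x\<close> to \<open>l\<^sup>-\<^sup>1 x r\<close> contributed by the pair \<open>(l, r)\<close>,
  so distinct pairs give distinct, possibly parallel, arcs.
\<close>

definition two_sided_Cayley ::
  "('a, 'm) monoid_scheme \<Rightarrow> 'a set \<Rightarrow> 'a set \<Rightarrow> ('a, 'a \<times> 'a \<times> 'a) pre_digraph" where
  "two_sided_Cayley G L R =
    \<lparr> verts = carrier G,
      arcs = carrier G \<times> L \<times> R,
      tail = (\<lambda>(x, l, r). x),
      head = (\<lambda>(x, l, r). inv\<^bsub>G\<^esub> l \<otimes>\<^bsub>G\<^esub> x \<otimes>\<^bsub>G\<^esub> r) \<rparr>"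

text \<open>
  Neither the library locale \<open>graph\<close> nor its vertex degrees fit here, since the former assumes
  finiteness and the latter are natural numbers; the group and \<open>L\<close>, \<open>R\<close> may be infinite.
\<close>

definition simple_undirected :: "('v, 'e) pre_digraph \<Rightarrow> bool" where
  "simple_undirected D \<longleftrightarrow> sym_digraph D \<and> loopfree_digraph D \<and> nomulti_digraph D"

text \<open>
  Every vertex has exactly \<open>k\<close> neighbours, where \<open>k\<close> is a cardinal. Only adjacent vertices are
  counted, so this is the valency of a simple undirected graph and ignores multiplicities.
\<close>

definition has_valency :: "('v, 'e) pre_digraph \<Rightarrow> 'k rel \<Rightarrow> bool" where
  "has_valency D k \<longleftrightarrow> (\<forall>v \<in> verts D. |{w \<in> verts D. v \<rightarrow>\<^bsub>D\<^esub> w}| =o k)"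

definition set_conj :: "('a, 'm) monoid_scheme \<Rightarrow> 'a set \<Rightarrow> 'a \<Rightarrow> 'a set" where
  "set_conj G X g = (inv\<^bsub>G\<^esub> g <#\<^bsub>G\<^esub> X) #>\<^bsub>G\<^esub> g"

definition two_S_Cayley_property ::
  "('a, 'm) monoid_scheme \<Rightarrow> 'a set \<Rightarrow> 'a set \<Rightarrow> bool" where
  "two_S_Cayley_property G L R \<longleftrightarrow>
    L \<subseteq> carrier G \<and> R \<subseteq> carrier G \<and> L \<noteq> {} \<and> R \<noteq> {} \<and>
    (\<forall>g \<in> carrier G.
      (set_inv\<^bsub>G\<^esub> L #>\<^bsub>G\<^esub> g) <#>\<^bsub>G\<^esub> R = (L #>\<^bsub>G\<^esub> g) <#>\<^bsub>G\<^esub> (set_inv\<^bsub>G\<^esub> R)) \<and>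
    (\<forall>g \<in> carrier G. set_conj G L g \<inter> R = {}) \<and>
    (\<forall>g \<in> carrier G.
      set_conj G (L <#>\<^bsub>G\<^esub> (set_inv\<^bsub>G\<^esub> L)) g \<inter> (R <#>\<^bsub>G\<^esub> (set_inv\<^bsub>G\<^esub> R)) = {\<one>\<^bsub>G\<^esub>})"

end

theory Submission
  imports Defs
begin

text \<open>
  Each clause of the 2S-Cayley property is one clause of being a simple undirected graph, written
  as an identity between subsets of the group. The out-neighbours of \<open>g\<close> form the set
  \<open>L\<^sup>-\<^sup>1 g R\<close>; solving \<open>g = l\<^sup>-\<^sup>1 y r\<close> for \<open>y\<close> shows that its in-neighbours form \<open>L g R\<^sup>-\<^sup>1\<close>, so
  adjacency is symmetric exactly when these two sets always agree
  (\<open>symmetric_two_sided_Cayley_iff\<close>). A loop \<open>g = l\<^sup>-\<^sup>1 g r\<close> says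
  \<open>g\<^sup>-\<^sup>1 l g = r\<close>, a common element of \<open>L\<^sup>g\<close> and \<open>R\<close>
  (\<open>loopfree_two_sided_Cayley_iff\<close>). Two parallel arcs
  \<open>l'\<^sup>-\<^sup>1 g r' = l\<^sup>-\<^sup>1 g r\<close> say \<open>g\<^sup>-\<^sup>1 (l l'\<^sup>-\<^sup>1) g = r r'\<^sup>-\<^sup>1\<close>, a common element of
  \<open>(L L\<^sup>-\<^sup>1)\<^sup>g\<close> and \<open>R R\<^sup>-\<^sup>1\<close>, which is trivial exactly when \<open>l = l'\<close> and \<open>r = r'\<close>
  (\<open>nomulti_two_sided_Cayley_iff\<close>).

  The valency is then immediate: without parallel arcs, distinct pairs \<open>(l, r)\<close> lead from a given
  vertex to distinct neighbours, so the neighbourhood is a bijective copy of \<open>L \<times> R\<close>.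
\<close>

context group
begin

lemma two_sided_Cayley_dominates_iff:
  "x \<rightarrow>\<^bsub>two_sided_Cayley G L R\<^esub> y \<longleftrightarrow>
    x \<in> carrier G \<and> (\<exists>l\<in>L. \<exists>r\<in>R. y = inv l \<otimes> x \<otimes> r)"
  unfolding arcs_ends_def arc_to_ends_def two_sided_Cayley_def by (fastforce simp: image_iff)

lemma wf_digraph_two_sided_Cayley:
  assumes "L \<subseteq> carrier G" "R \<subseteq> carrier G"
  shows "wf_digraph (two_sided_Cayley G L R)"
  using assms by unfold_locales (auto simp: two_sided_Cayley_def subset_iff)

lemma inv_mult_mult_eq_iff:
  assumes "l \<in> carrier G" "x \<in> carrier G" "y \<in> carrier G" "r \<in> carrier G"
  shows "y = inv l \<otimes> x \<otimes> r \<longleftrightarrow> x = l \<otimes> y \<otimes> inv r"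
proof -
  have "y = inv l \<otimes> x \<otimes> r \<longleftrightarrow> y = inv l \<otimes> (x \<otimes> r)"
    using assms by (simp add: m_assoc)
  also have "\<dots> \<longleftrightarrow> x \<otimes> r = l \<otimes> y"
    using assms by (intro inv_solve_left) auto
  also have "\<dots> \<longleftrightarrow> x = l \<otimes> y \<otimes> inv r"
    using assms inv_solve_right[of x "l \<otimes> y" r] by auto
  finally show ?thesis .
qed

lemma out_neighbours_eq:
  assumes "L \<subseteq> carrier G" "R \<subseteq> carrier G" "g \<in> carrier G"
  shows "(set_inv L #> g) <#> R = {y. g \<rightarrow>\<^bsub>two_sided_Cayley G L R\<^esub> y}"
  using assms unfolding two_sided_Cayley_dominates_iff
  by (auto simp: set_mult_def r_coset_def SET_INV_def)

lemma in_neighbours_eq: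
  assumes "L \<subseteq> carrier G" "R \<subseteq> carrier G" "g \<in> carrier G"
  shows "(L #> g) <#> set_inv R = {y. y \<rightarrow>\<^bsub>two_sided_Cayley G L R\<^esub> g}"
proof -
  have "(L #> g) <#> set_inv R = {y. \<exists>l\<in>L. \<exists>r\<in>R. y = l \<otimes> g \<otimes> inv r}"
    by (auto simp: set_mult_def r_coset_def SET_INV_def)
  also have "\<dots> = {y. y \<rightarrow>\<^bsub>two_sided_Cayley G L R\<^esub> g}"
  proof -
    have "y = l \<otimes> g \<otimes> inv r \<longleftrightarrow> y \<in> carrier G \<and> g = inv l \<otimes> y \<otimes> r"
      if "l \<in> L" "r \<in> R" for y l r
    proof -
      have "l \<in> carrier G" "r \<in> carrier G"
        using that assms by auto
      then show ?thesis
        using assms(3) inv_mult_mult_eq_iff[of l y g r] by auto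
    qed
    then show ?thesis
      unfolding two_sided_Cayley_dominates_iff by blast
  qed
  finally show ?thesis .
qed

text \<open>
  Symmetry says that the out-neighbours and the in-neighbours of every vertex coincide. Points
  outside the carrier are adjacent to nothing, so it is enough to compare them on the carrier.
\<close>
lemma symmetric_two_sided_Cayley_iff:
  assumes "L \<subseteq> carrier G" "R \<subseteq> carrier G"
  shows "symmetric (two_sided_Cayley G L R) \<longleftrightarrow>
    (\<forall>g \<in> carrier G. (set_inv L #> g) <#> R = (L #> g) <#> set_inv R)"
proof -
  interpret wf_digraph "two_sided_Cayley G L R"
    using assms by (rule wf_digraph_two_sided_Cayley)
  have "x \<in> carrier G" "y \<in> carrier G" if "x \<rightarrow>\<^bsub>two_sided_Cayley G L R\<^esub> y" for x y
    using adj_in_verts[OF that] by (simp_all add: two_sided_Cayley_def)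
  then show ?thesis
    using assms by (simp add: out_neighbours_eq in_neighbours_eq symmetric_def sym_def
        set_eq_iff) blast
qed

lemma set_conj_eq: "set_conj G X g = {inv g \<otimes> x \<otimes> g |x. x \<in> X}"
  by (auto simp: set_conj_def l_coset_def r_coset_def)

lemma mult_set_inv_eq: "X <#> set_inv Y = (\<lambda>(x, y). x \<otimes> inv y) ` (X \<times> Y)"
  by (force simp: set_mult_def SET_INV_def)

lemma conj_quotients_eq:
  "set_conj G (X <#> set_inv Y) g = (\<lambda>(x, y). inv g \<otimes> (x \<otimes> inv y) \<otimes> g) ` (X \<times> Y)"
  by (force simp: set_conj_eq mult_set_inv_eq)

lemma loop_iff_conj:
  assumes "l \<in> carrier G" "x \<in> carrier G" "r \<in> carrier G"
  shows "x = inv l \<otimes> x \<otimes> r \<longleftrightarrow> inv x \<otimes> l \<otimes> x = r"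
proof -
  have "x = inv l \<otimes> x \<otimes> r \<longleftrightarrow> x = inv l \<otimes> (x \<otimes> r)"
    using assms by (simp add: m_assoc)
  also have "\<dots> \<longleftrightarrow> x \<otimes> r = l \<otimes> x"
    using assms by (intro inv_solve_left) auto
  also have "\<dots> \<longleftrightarrow> inv x \<otimes> (l \<otimes> x) = r"
    using assms inv_solve_left'[of r x "l \<otimes> x"] by auto
  also have "\<dots> \<longleftrightarrow> inv x \<otimes> l \<otimes> x = r"
    using assms by (simp add: m_assoc)
  finally show ?thesis .
qed

lemma loopfree_two_sided_Cayley_iff:
  assumes "L \<subseteq> carrier G" "R \<subseteq> carrier G"
  shows "loopfree_digraph (two_sided_Cayley G L R) \<longleftrightarrow>
    (\<forall>g \<in> carrier G. set_conj G L g \<inter> R = {})"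
proof -
  have "loopfree_digraph (two_sided_Cayley G L R) \<longleftrightarrow>
      (\<forall>g \<in> carrier G. \<forall>l\<in>L. \<forall>r\<in>R. g \<noteq> inv l \<otimes> g \<otimes> r)"
    using wf_digraph_two_sided_Cayley[OF assms]
    by (auto simp: loopfree_digraph_def loopfree_digraph_axioms_def two_sided_Cayley_def)
  also have "\<dots> \<longleftrightarrow> (\<forall>g \<in> carrier G. \<forall>l\<in>L. \<forall>r\<in>R. inv g \<otimes> l \<otimes> g \<noteq> r)"
    using assms loop_iff_conj by (meson subsetD)
  also have "\<dots> \<longleftrightarrow> (\<forall>g \<in> carrier G. set_conj G L g \<inter> R = {})"
    by (auto simp: set_conj_eq)
  finally show ?thesis .
qed

lemma parallel_iff_conj:
  assumes "l \<in> carrier G" "l' \<in> carrier G" "x \<in> carrier G" "r \<in> carrier G" "r' \<in> carrier G"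
  shows "inv l' \<otimes> x \<otimes> r' = inv l \<otimes> x \<otimes> r \<longleftrightarrow> inv x \<otimes> (l \<otimes> inv l') \<otimes> x = r \<otimes> inv r'"
proof -
  let ?a = "inv l' \<otimes> x \<otimes> r'" and ?b = "inv l \<otimes> x \<otimes> r"
  \<comment> \<open>Multiplying by \<open>inv x \<otimes> l\<close> on the left and \<open>inv r'\<close> on the right moves
    \<open>l, l'\<close> to one side and \<open>r, r'\<close> to the other.\<close>
  have "?a = ?b \<longleftrightarrow> inv x \<otimes> l \<otimes> ?a = inv x \<otimes> l \<otimes> ?b"
    using assms by (intro Units_l_cancel[symmetric]) auto
  also have "\<dots> \<longleftrightarrow> inv x \<otimes> l \<otimes> ?a \<otimes> inv r' = inv x \<otimes> l \<otimes> ?b \<otimes> inv r'"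
    using assms by (intro right_cancel[symmetric]) auto
  also have "inv x \<otimes> l \<otimes> ?a \<otimes> inv r' = inv x \<otimes> (l \<otimes> inv l') \<otimes> x"
    using assms by (simp add: m_assoc)
  also have "inv x \<otimes> l \<otimes> ?b \<otimes> inv r' = r \<otimes> inv r'"
  proof -
    have "l \<otimes> ?b = x \<otimes> r"
      using assms inv_solve_left[of ?b l "x \<otimes> r"] by (simp add: m_assoc)
    moreover have "inv x \<otimes> (x \<otimes> r) = r"
      using assms inv_solve_left'[of r x "x \<otimes> r"] by simp
    ultimately have "inv x \<otimes> l \<otimes> ?b = r"
      using assms m_assoc[of "inv x" l ?b] by simp
    then show ?thesis by simp
  qed
  finally show ?thesis .
qed

lemma conj_eq_one_iff:
  assumes "a \<in> carrier G" "g \<in> carrier G"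
  shows "inv g \<otimes> a \<otimes> g = \<one> \<longleftrightarrow> a = \<one>"
proof -
  have "inv g \<otimes> a \<otimes> g = \<one> \<longleftrightarrow> a \<otimes> g = g"
    using assms inv_solve_left'[of \<one> g "a \<otimes> g"] by (simp add: m_assoc)
  also have "\<dots> \<longleftrightarrow> a = \<one>"
    using assms by simp
  finally show ?thesis .
qed

lemma mult_inv_eq_one_iff:
  assumes "a \<in> carrier G" "b \<in> carrier G"
  shows "a \<otimes> inv b = \<one> \<longleftrightarrow> a = b"
  using assms inv_solve_right'[of \<one> a b] by auto

text \<open>
  A common element is some \<open>g\<^sup>-\<^sup>1 (l l'\<^sup>-\<^sup>1) g = r r'\<^sup>-\<^sup>1\<close>, that is, a pair of parallel arcs. When it is
  \<open>\<one>\<close>, both \<open>l = l'\<close> and \<open>r = r'\<close>, so the two arcs are the same; this always happens for some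
  choice because \<open>L\<close> and \<open>R\<close> are nonempty, hence \<open>{\<one>}\<close> rather than the empty set.
\<close>
lemma nomulti_two_sided_Cayley_iff:
  assumes "L \<subseteq> carrier G" "R \<subseteq> carrier G" "L \<noteq> {}" "R \<noteq> {}"
  shows "nomulti_digraph (two_sided_Cayley G L R) \<longleftrightarrow>
    (\<forall>g \<in> carrier G. set_conj G (L <#> set_inv L) g \<inter> (R <#> set_inv R) = {\<one>})"
proof -
  note in_G = subsetD[OF assms(1)] subsetD[OF assms(2)]
  have parallel: "inv l' \<otimes> g \<otimes> r' = inv l \<otimes> g \<otimes> r \<longleftrightarrow>
      inv g \<otimes> (l \<otimes> inv l') \<otimes> g = r \<otimes> inv r'"
    and trivial: "inv g \<otimes> (l \<otimes> inv l') \<otimes> g = r \<otimes> inv r' \<Longrightarrow>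
      l = l' \<and> r = r' \<longleftrightarrow> r \<otimes> inv r' = \<one>"
    if "g \<in> carrier G" "l \<in> L" "l' \<in> L" "r \<in> R" "r' \<in> R" for g l l' r r'
  proof -
    have carrier: "l \<in> carrier G" "l' \<in> carrier G" "r \<in> carrier G" "r' \<in> carrier G"
      using that in_G by auto
    show "inv l' \<otimes> g \<otimes> r' = inv l \<otimes> g \<otimes> r \<longleftrightarrow> inv g \<otimes> (l \<otimes> inv l') \<otimes> g = r \<otimes> inv r'"
      using that(1) carrier by (intro parallel_iff_conj)
    show "l = l' \<and> r = r' \<longleftrightarrow> r \<otimes> inv r' = \<one>"
      if "inv g \<otimes> (l \<otimes> inv l') \<otimes> g = r \<otimes> inv r'"
      using conj_eq_one_iff[of "l \<otimes> inv l'" g] that \<open>g \<in> carrier G\<close> carrier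
      by (auto simp: mult_inv_eq_one_iff)
  qed
  have "\<one> \<in> set_conj G (L <#> set_inv L) g \<inter> (R <#> set_inv R)" if "g \<in> carrier G" for g
  proof -
    obtain l r where lr: "l \<in> L" "r \<in> R"
      using assms(3,4) by blast
    then have "\<one> = inv g \<otimes> (l \<otimes> inv l) \<otimes> g" "\<one> = r \<otimes> inv r"
      using that in_G by simp_all
    then show ?thesis
      using lr unfolding conj_quotients_eq unfolding mult_set_inv_eq by force
  qed
  then have "(\<forall>g \<in> carrier G. set_conj G (L <#> set_inv L) g \<inter> (R <#> set_inv R) = {\<one>}) \<longleftrightarrow>
      (\<forall>g \<in> carrier G. set_conj G (L <#> set_inv L) g \<inter> (R <#> set_inv R) \<subseteq> {\<one>})"
    by blast
  also have "\<dots> \<longleftrightarrow> (\<forall>g \<in> carrier G. \<forall>l\<in>L. \<forall>l'\<in>L. \<forall>r\<in>R. \<forall>r'\<in>R.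
      inv g \<otimes> (l \<otimes> inv l') \<otimes> g = r \<otimes> inv r' \<longrightarrow> r \<otimes> inv r' = \<one>)"
  proof -
    have "f ` (L \<times> L) \<inter> h ` (R \<times> R) \<subseteq> {\<one>} \<longleftrightarrow>
        (\<forall>l\<in>L. \<forall>l'\<in>L. \<forall>r\<in>R. \<forall>r'\<in>R. f (l, l') = h (r, r') \<longrightarrow> h (r, r') = \<one>)"
      for f h :: "'a \<times> 'a \<Rightarrow> 'a"
    proof -
      have "f ` (L \<times> L) \<inter> h ` (R \<times> R) \<subseteq> {\<one>} \<longleftrightarrow>
          (\<forall>p\<in>L \<times> L. \<forall>q\<in>R \<times> R. f p = h q \<longrightarrow> h q = \<one>)"
        by fastforce
      then show ?thesis by simp
    qed
    then show ?thesis
      unfolding conj_quotients_eq unfolding mult_set_inv_eq by simp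
  qed
  also have "\<dots> \<longleftrightarrow> (\<forall>g \<in> carrier G. \<forall>l\<in>L. \<forall>l'\<in>L. \<forall>r\<in>R. \<forall>r'\<in>R.
      inv l' \<otimes> g \<otimes> r' = inv l \<otimes> g \<otimes> r \<longrightarrow> l = l' \<and> r = r')"
    by (intro ball_cong refl) (simp add: parallel trivial cong: imp_cong)
  also have "\<dots> \<longleftrightarrow> nomulti_digraph (two_sided_Cayley G L R)"
    using wf_digraph_two_sided_Cayley[OF assms(1,2)]
    by (auto simp: nomulti_digraph_def nomulti_digraph_axioms_def two_sided_Cayley_def
        arc_to_ends_def)
  finally show ?thesis by simp
qed

lemma two_sided_Cayley_has_valency:
  assumes "L \<subseteq> carrier G" "R \<subseteq> carrier G"
    and "nomulti_digraph (two_sided_Cayley G L R)"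
  shows "has_valency (two_sided_Cayley G L R) ( |L| *c |R| )"
  unfolding has_valency_def
proof
  let ?D = "two_sided_Cayley G L R"
  fix v assume "v \<in> verts ?D"
  then have v: "v \<in> carrier G"
    by (simp add: two_sided_Cayley_def)
  let ?f = "\<lambda>(l, r). inv l \<otimes> v \<otimes> r"
  have "inj_on ?f (L \<times> R)"
  proof (rule inj_onI)
    fix p q assume "p \<in> L \<times> R" "q \<in> L \<times> R" "?f p = ?f q"
    then have "(v, p) \<in> arcs ?D" "(v, q) \<in> arcs ?D"
        "arc_to_ends ?D (v, p) = arc_to_ends ?D (v, q)"
      using v by (auto simp: two_sided_Cayley_def arc_to_ends_def)
    then have "(v, p) = (v, q)"
      by (rule nomulti_digraph.no_multi_arcs[OF assms(3)])
    then show "p = q" by simp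
  qed
  moreover have "?f ` (L \<times> R) = {w \<in> verts ?D. v \<rightarrow>\<^bsub>?D\<^esub> w}"
  proof -
    have "w \<in> verts ?D" if "v \<rightarrow>\<^bsub>?D\<^esub> w" for w
      using wf_digraph.adj_in_verts(2)[OF wf_digraph_two_sided_Cayley[OF assms(1,2)] that] .
    then show ?thesis
      using v by (fastforce simp: two_sided_Cayley_dominates_iff)
  qed
  ultimately have "bij_betw ?f (L \<times> R) {w \<in> verts ?D. v \<rightarrow>\<^bsub>?D\<^esub> w}"
    by (rule bij_betw_imageI)
  then have "|L \<times> R| =o |{w \<in> verts ?D. v \<rightarrow>\<^bsub>?D\<^esub> w}|"
    by (rule card_of_ordIsoI)
  then show "|{w \<in> verts ?D. v \<rightarrow>\<^bsub>?D\<^esub> w}| =o |L| *c |R|"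
    unfolding cprod_def Field_card_of by (rule ordIso_symmetric)
qed

end

theorem theorem1p3:
  fixes G :: "('a, 'm) monoid_scheme" and L R :: "'a set"
  assumes "group G"
    and "L \<subseteq> carrier G" and "R \<subseteq> carrier G"
    and "L \<noteq> {}" and "R \<noteq> {}"
  shows "(simple_undirected (two_sided_Cayley G L R) \<longleftrightarrow> two_S_Cayley_property G L R) \<and>
    (two_S_Cayley_property G L R \<longrightarrow>
      has_valency (two_sided_Cayley G L R) ( |L| *c |R| ))"
proof -
  interpret group G by fact
  have "sym_digraph (two_sided_Cayley G L R) \<longleftrightarrow> symmetric (two_sided_Cayley G L R)"
    using wf_digraph_two_sided_Cayley[OF assms(2,3)]
    by (simp add: sym_digraph_def sym_digraph_axioms_def)
  then have "simple_undirected (two_sided_Cayley G L R) \<longleftrightarrow> two_S_Cayley_property G L R"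
    unfolding simple_undirected_def two_S_Cayley_property_def
    using assms by (simp add: symmetric_two_sided_Cayley_iff loopfree_two_sided_Cayley_iff
        nomulti_two_sided_Cayley_iff)
  moreover have "has_valency (two_sided_Cayley G L R) ( |L| *c |R| )"
    if "simple_undirected (two_sided_Cayley G L R)"
    using that two_sided_Cayley_has_valency[OF assms(2,3)] by (simp add: simple_undirected_def)
  ultimately show ?thesis by blast
qed

end
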